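(* For every $\delta>0$ and all real numbers $\lambda_0,\dots,\lambda_{n-1}\ge0$, the capacity of the BC-OIC is upper-bounded as $$\mathsf{C}_{\mathrm B}(\mathbf{h},\boldsymbol{\alpha},\sigma)\le\log\left(1+\frac{\mathsf{P}}{\sqrt{2\pi e}\,\sigma}\right)+\sum_{i=0}^{n-1}\lambda_i(1-\mathsf{H}_{[i]})\bar\alpha_i+\sum_{i=0}^{n-1}\frac{\lambda_i\sigma}{\sqrt{2\pi}}\left(1-e^{-\frac{(1+\delta)^2}{2\sigma^2}}\right),$$ where $$\mathsf{P}=\int_0^{1+\delta}\exp\left(-\lambda_0y-\sum_{i=1}^{n-1}\lambda_i(y-\mathsf{H}_{[i]})_+\right)dy.$$
   Context: Let $n\ge 2$ be an integer, $\mathbf{h}=(h_1,\dots,h_n)^{\mathsf T}$ with $h_k>0$ and $\sum_{k=1}^n h_k=1$, and $\boldsymbol{\alpha}=(\alpha_1,\dots,\alpha_n)^{\mathsf T}$ with $1\ge\alpha_1>\alpha_2>\cdots>\alpha_n>0$ and $\alpha_n\le \tfrac12$. Put $\mathsf{H}_{[0]}=0$, $\mathsf{H}_{[k]}=\sum_{i=1}^k h_i$ and $\bar\alpha_k=\frac{\sum_{i=k+1}^n h_i\alpha_i}{1-\mathsf{H}_{[k]}}$ for $0\le k\le n-1$, and $(a)_+=\max\{a,0\}$. Channel: $Y=\mathbf{h}^{\mathsf T}\mathbf{X}+Z$ with $Z\sim\mathcal{N}(0,\sigma^2)$, $\sigma>0$, independent of $\mathbf{X}=(X_1,\dots,X_n)^{\mathsf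 T}$. The BC-OIC capacity is $\mathsf{C}_{\mathrm B}(\mathbf{h},\boldsymbol{\alpha},\sigma)=\sup I(\mathbf{X};Y)$, the supremum being over all laws of $\mathbf{X}$ with $0\le X_k\le1$ (almost surely) and $\mathbb{E}[X_k]\le\alpha_k$ for all $k\in\{1,\dots,n\}$. $I$ is mutual information in nats; $\log$ is the natural logarithm. *)

theory Defs
  imports "HOL-Probability.Probability"
begin

text \<open>
  Vectors are functions \<open>nat \<Rightarrow> real\<close> read on the index set \<open>{1..n}\<close>; the space of input vectors
  is the product \<open>\<Pi>\<^sub>M k\<in>{1..n}. borel\<close>.
\<close>

definition cumsum :: "(nat \<Rightarrow> real) \<Rightarrow> nat \<Rightarrow> real" where
  "cumsum h k = (\<Sum>i=1..k. h i)"

definition tail_mean :: "nat \<Rightarrow> (nat \<Rightarrow> real) \<Rightarrow> (nat \<Rightarrow> real) \<Rightarrow> nat \<Rightarrow> real" where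
  "tail_mean n h \<alpha> k = (\<Sum>i=k+1..n. h i * \<alpha> i) / (1 - cumsum h k)"

definition pos_part :: "real \<Rightarrow> real" where
  "pos_part a = max a 0"

abbreviation input_space :: "nat \<Rightarrow> (nat \<Rightarrow> real) measure" where
  "input_space n \<equiv> (\<Pi>\<^sub>M k\<in>{1..n}. (borel :: real measure))"

text \<open>The peak constraint makes the coordinates integrable, so the Bochner integral below is
  their expectation.\<close>

definition admissible_laws :: "nat \<Rightarrow> (nat \<Rightarrow> real) \<Rightarrow> (nat \<Rightarrow> real) measure set" where
  "admissible_laws n \<alpha> = {\<mu>. prob_space \<mu> \<and> sets \<mu> = sets (input_space n) \<and>
     (\<forall>k\<in>{1..n}. (AE x in \<mu>. 0 \<le> x k \<and> x k \<le> 1) \<and> (\<integral>x. x k \<partial>\<mu>) \<le> \<alpha> k)}"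

text \<open>
  Independence of input and noise: their joint law is the product measure.  The input and the
  channel output are then random variables on this product space.
\<close>

definition channel_space :: "real \<Rightarrow> (nat \<Rightarrow> real) measure \<Rightarrow> ((nat \<Rightarrow> real) \<times> real) measure" where
  "channel_space \<sigma> \<mu> = \<mu> \<Otimes>\<^sub>M density lborel (normal_density 0 \<sigma>)"

definition channel_output :: "nat \<Rightarrow> (nat \<Rightarrow> real) \<Rightarrow> (nat \<Rightarrow> real) \<times> real \<Rightarrow> real" where
  "channel_output n h = (\<lambda>(x, z). (\<Sum>k=1..n. h k * x k) + z)"

text \<open>
  Base \<open>exp 1\<close> measures information in nats.  The library's mutual information is real-valued;
  nothing is lost for admissible laws, since the input is bounded and the noise is Gaussian, so
  that the divergence of the joint law from the product of the marginals exists and is finite.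
\<close>

definition channel_information ::
  "nat \<Rightarrow> (nat \<Rightarrow> real) \<Rightarrow> real \<Rightarrow> (nat \<Rightarrow> real) measure \<Rightarrow> real" where
  "channel_information n h \<sigma> \<mu> =
     prob_space.mutual_information (channel_space \<sigma> \<mu>) (exp 1) (input_space n) borel
       fst (channel_output n h)"

text \<open>
  The supremum is taken in \<open>ereal\<close>, so that an upper bound on it is meaningful without knowing
  beforehand that the set of achievable values is bounded.
\<close>

definition capacity_BC :: "nat \<Rightarrow> (nat \<Rightarrow> real) \<Rightarrow> (nat \<Rightarrow> real) \<Rightarrow> real \<Rightarrow> ereal" where
  "capacity_BC n h \<alpha> \<sigma> =
     (SUP \<mu>\<in>admissible_laws n \<alpha>. ereal (channel_information n h \<sigma> \<mu>))"

definition P_int :: "nat \<Rightarrow> (nat \<Rightarrow> real) \<Rightarrow> (nat \<Rightarrow> real) \<Rightarrow> real \<Rightarrow> real" where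
  "P_int n h lam \<delta> =
     integral {0..1 + \<delta>}
       (\<lambda>y. exp (- lam 0 * y - (\<Sum>i=1..n-1. lam i * pos_part (y - cumsum h i))))"

end

theory Submission imports Defs begin

text \<open>
  Duality: for every output density \<open>r\<close> the mutual information is at most the average over the
  input of the divergence of the conditional output law from \<open>r\<close>.  Take \<open>r\<close> proportional to
  \<open>exp (- L)\<close>, where on \<open>[0, 1 + \<delta>]\<close> the function \<open>L\<close> is
  \<open>\<Sum>i. \<lambda>\<^sub>i (y - H\<^sub>i)\<^sub>+\<close> and outside this interval \<open>L\<close> is the exponent of a Gaussian
  tail, scaled such that \<open>\<integral> exp (- L) = P + sqrt (2 \<pi> e) \<sigma>\<close>.  Against a Gaussian centred at an
  input \<open>s \<in> [0, 1 + \<delta>]\<close> the tails of \<open>L\<close> contribute nothing positive, while inside the interval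
  \<open>(y - H\<^sub>i)\<^sub>+\<close> costs at most \<open>(s - H\<^sub>i)\<^sub>+\<close> plus a truncated first moment.  Since
  \<open>X\<^sub>k \<le> 1\<close>, the former is at most \<open>\<Sum>k>i. h\<^sub>k X\<^sub>k\<close>.
\<close>

subsection \<open>Dual bound on mutual information\<close>

text \<open>Replacing the true output density by \<open>r\<close> adds the divergence of the output
  law from \<open>r\<close>, which is nonnegative because \<open>r\<close> has mass at most 1. The
  reference measure \<open>S\<close> is the law of \<open>X\<close> itself, so \<open>X\<close> has
  density 1 and discrete or singular inputs are covered as well.\<close>

lemma (in information_space) mutual_information_le_dual:
  fixes f :: "'b \<times> 'c \<Rightarrow> real" and r :: "'c \<Rightarrow> real"
  assumes S: "prob_space S" and T: "sigma_finite_measure T"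
    and X: "distr M S X = S" and [measurable]: "X \<in> measurable M S"
    and D: "distributed M (S \<Otimes>\<^sub>M T) (\<lambda>\<omega>. (X \<omega>, Y \<omega>)) f"
    and fm [measurable]: "f \<in> borel_measurable (S \<Otimes>\<^sub>M T)"
    and fpos: "\<And>x y. x \<in> space S \<Longrightarrow> y \<in> space T \<Longrightarrow> 0 < f (x, y)"
    and rm [measurable]: "r \<in> borel_measurable T"
    and rpos: "\<And>y. y \<in> space T \<Longrightarrow> 0 < r y"
    and r1: "(\<integral>\<^sup>+y. r y \<partial>T) \<le> 1"
    and int: "integrable (S \<Otimes>\<^sub>M T) (\<lambda>z. f z * log b (f z / r (snd z)))"
  shows "mutual_information b S T X Y \<le> (\<integral>z. f z * log b (f z / r (snd z)) \<partial>(S \<Otimes>\<^sub>M T))"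
proof -
  interpret S: prob_space S by fact
  interpret T: sigma_finite_measure T by fact
  interpret ST: pair_sigma_finite S T ..
  have lnb: "0 < ln b" using b_gt_1 by simp
  define p where "p y = (\<integral>\<^sup>+x. f (x, y) \<partial>S)" for y
  have pm [measurable]: "p \<in> borel_measurable T"
    unfolding p_def by measurable
  have Dp: "distributed M T Y p"
    unfolding p_def using distr_marginal2[OF S.sigma_finite_measure_axioms T D] .
  have f_nn1: "(\<integral>\<^sup>+z. f z \<partial>(S \<Otimes>\<^sub>M T)) = 1"
  proof -
    have "(\<integral>\<^sup>+z. f z \<partial>(S \<Otimes>\<^sub>M T)) = emeasure (density (S \<Otimes>\<^sub>M T) f) (space (S \<Otimes>\<^sub>M T))"
      by (subst emeasure_density) (auto intro!: nn_integral_cong simp: space_pair_measure)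
    also have "\<dots> = 1"
      using prob_space.emeasure_space_1[OF prob_space_distr[OF distributed_measurable[OF D]]]
      by (simp add: distributed_distr_eq_density[OF D])
    finally show ?thesis .
  qed
  have p_nn1: "(\<integral>\<^sup>+y. p y \<partial>T) = 1"
    unfolding p_def using ST.nn_integral_snd[of f] f_nn1 by simp
  have p_fin: "AE y in T. p y \<noteq> \<infinity>"
    by (rule nn_integral_PInf_AE) (auto simp: p_nn1)
  \<comment> \<open>A real-valued version of the output density. It differs from \<open>p\<close>
    only on the null set where \<open>p\<close> is infinite; the value 1 there keeps
    \<open>q\<close> positive everywhere, so logarithms and quotients need no exceptional
    points.\<close>
  define q where "q y = (if p y = \<infinity> then 1 else enn2real (p y))" for y
  have qm [measurable]: "q \<in> borel_measurable T"
    unfolding q_def by measurable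
  have pq: "AE y in T. p y = ennreal (q y)"
    using p_fin by eventually_elim (auto simp: q_def less_top)
  have p0: "p y \<noteq> 0" if y: "y \<in> space T" for y
  proof
    assume "p y = 0"
    then have "AE x in S. ennreal (f (x, y)) = 0"
      unfolding p_def using y by (subst (asm) nn_integral_0_iff_AE) auto
    then have "AE x in S. False"
      using AE_space by eventually_elim (use fpos[OF _ y] in \<open>force simp: ennreal_eq_0_iff\<close>)
    then show False by simp
  qed
  have qpos: "0 < q y" if y: "y \<in> space T" for y
    using p0[OF y] by (auto simp: q_def enn2real_positive_iff less_top zero_less_iff_neq_zero)
  have Dq: "distributed M T Y q"
  proof -
    have "density T p = density T q"
      by (rule density_cong) (use pq in auto)
    then show ?thesis using Dp by (auto simp: distributed_def)
  qed
  have DX: "distributed M S X (\<lambda>_. 1)"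
    by (auto simp: distributed_def X density_1)
  let ?I = "\<lambda>z. f z * log b (f z / q (snd z))"
  let ?J = "\<lambda>z. f z * log b (f z / r (snd z))"
  have MI: "mutual_information b S T X Y = integral\<^sup>L (S \<Otimes>\<^sub>M T) ?I"
    using mutual_information_distr[OF S.sigma_finite_measure_axioms T, of X "\<lambda>_. 1" Y q f]
      DX Dq D by (simp add: less_imp_le fpos qpos)
  have f_int: "has_bochner_integral (S \<Otimes>\<^sub>M T) f 1"
    by (rule has_bochner_integral_nn_integral)
      (auto simp: f_nn1 space_pair_measure less_imp_le fpos intro!: AE_I2)
  have r_int: "integrable (S \<Otimes>\<^sub>M T) (\<lambda>z. r (snd z))"
    and r_le: "(\<integral>z. r (snd z) \<partial>(S \<Otimes>\<^sub>M T)) \<le> 1"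
  proof -
    have *: "(\<integral>\<^sup>+z. r (snd z) \<partial>(S \<Otimes>\<^sub>M T)) \<le> 1"
      using r1 by (subst T.nn_integral_fst[symmetric]) (auto simp: S.emeasure_space_1)
    have r_nn: "AE z in S \<Otimes>\<^sub>M T. 0 \<le> r (snd z)"
      by (auto simp: space_pair_measure less_imp_le rpos intro!: AE_I2)
    show "integrable (S \<Otimes>\<^sub>M T) (\<lambda>z. r (snd z))"
      by (rule integrableI_nonneg) (use * r_nn in \<open>auto intro: le_less_trans\<close>)
    then show "(\<integral>z. r (snd z) \<partial>(S \<Otimes>\<^sub>M T)) \<le> 1"
      using * nn_integral_eq_integral[OF _ r_nn] by simp
  qed
  \<comment> \<open>The pointwise form of Gibbs' inequality, from \<open>ln t \<le> t - 1\<close> at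
    \<open>t = v / u\<close>. Integrated, it compares a divergence with a difference of
    masses.\<close>
  have log_bound: "u * log b (u / v) \<ge> (u - v) / ln b" if "0 < u" "0 < v" for u v
  proof -
    have "ln (v / u) \<le> v / u - 1" using that by (intro ln_le_minus_one) auto
    then have "u * ln (v / u) \<le> v - u"
      using that by (simp add: field_simps)
    then have "u - v \<le> u * ln (u / v)" using that by (simp add: ln_div algebra_simps)
    then show ?thesis using lnb by (simp add: log_def divide_right_mono)
  qed
  show ?thesis
  proof (cases "integrable (S \<Otimes>\<^sub>M T) ?I")
    case False
    \<comment> \<open>The mutual information then has the junk value \<open>0\<close> of a divergent Bochner integral.\<close>
    have "0 \<le> (\<integral>z. (f z - r (snd z)) / ln b \<partial>(S \<Otimes>\<^sub>M T))"
      using f_int r_int r_le lnb by (simp add: has_bochner_integral_iff)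
    \<comment> \<open>Against the value 0 it suffices that the dual integral is nonnegative: by
      \<open>log_bound\<close> it dominates the mass of \<open>f\<close>, which is 1, minus the mass
      of \<open>r\<close>, up to the factor \<open>1 / ln b\<close>.\<close>
    also have "\<dots> \<le> integral\<^sup>L (S \<Otimes>\<^sub>M T) ?J"
      by (rule integral_mono)
        (use f_int r_int int fpos rpos log_bound in
          \<open>auto simp: has_bochner_integral_iff space_pair_measure\<close>)
    finally show ?thesis
      using False by (simp add: MI not_integrable_integral_eq)
  next
    case True
    \<comment> \<open>The joint density with output marginal \<open>r\<close> and the true
      conditional law of the input given the output, which has density \<open>f / q\<close>.
      Integrating out the input leaves \<open>r\<close>, so the mass is again at most 1.\<close>
    let ?R = "\<lambda>z. f z * r (snd z) / q (snd z)"
    have "(\<integral>\<^sup>+z. ?R z \<partial>(S \<Otimes>\<^sub>M T)) = (\<integral>\<^sup>+y. \<integral>\<^sup>+x. ennreal (r y / q y) * f (x, y) \<partial>S \<partial>T)"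
      by (subst ST.nn_integral_snd[symmetric])
        (auto intro!: nn_integral_cong simp: ennreal_mult[symmetric] less_imp_le fpos qpos rpos
          field_simps)
    also have "\<dots> = (\<integral>\<^sup>+y. ennreal (r y / q y) * p y \<partial>T)"
      unfolding p_def by (intro nn_integral_cong nn_integral_cmult) auto
    also have "\<dots> = (\<integral>\<^sup>+y. r y \<partial>T)"
    proof (rule nn_integral_cong_AE)
      show "AE y in T. ennreal (r y / q y) * p y = ennreal (r y)"
        using pq AE_space
      proof eventually_elim
        case (elim y)
        then show ?case using qpos[of y] rpos[of y]
          by (simp add: ennreal_mult[symmetric] less_imp_le)
      qed
    qed
    finally have R1: "(\<integral>\<^sup>+z. ?R z \<partial>(S \<Otimes>\<^sub>M T)) \<le> 1" using r1 by simp
    have R_nn: "AE z in S \<Otimes>\<^sub>M T. 0 \<le> ?R z"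
      by (auto simp: space_pair_measure less_imp_le rpos fpos qpos intro!: AE_I2)
    have R_int: "integrable (S \<Otimes>\<^sub>M T) ?R"
      by (rule integrableI_nonneg) (use R1 R_nn in \<open>auto intro: le_less_trans\<close>)
    have R_le: "(\<integral>z. ?R z \<partial>(S \<Otimes>\<^sub>M T)) \<le> 1"
      using R1 nn_integral_eq_integral[OF R_int R_nn] by simp
    have "integral\<^sup>L (S \<Otimes>\<^sub>M T) ?I \<le> (\<integral>z. ?J z + (?R z - f z) / ln b \<partial>(S \<Otimes>\<^sub>M T))"
    proof (rule integral_mono[OF True])
      show "integrable (S \<Otimes>\<^sub>M T) (\<lambda>z. ?J z + (?R z - f z) / ln b)"
        using f_int R_int int by (auto simp: has_bochner_integral_iff)
      fix z assume "z \<in> space (S \<Otimes>\<^sub>M T)"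
      then have pos: "0 < f z" "0 < r (snd z)" "0 < q (snd z)"
        using fpos rpos qpos by (auto simp: space_pair_measure)
      \<comment> \<open>The gap between dual and true integrand is the divergence integrand of
        \<open>f\<close> against \<open>?R\<close>, so \<open>log_bound\<close> applies to that
        pair.\<close>
      have "?J z - ?I z = f z * log b (f z / (f z * r (snd z) / q (snd z)))"
        using pos b_gt_1 by (simp add: log_divide log_mult algebra_simps)
      also have "\<dots> \<ge> (f z - ?R z) / ln b"
        by (rule log_bound) (use pos in auto)
      finally show "?I z \<le> ?J z + (?R z - f z) / ln b"
        by (simp add: diff_divide_distrib)
    qed
    also have "\<dots> = integral\<^sup>L (S \<Otimes>\<^sub>M T) ?J + ((\<integral>z. ?R z \<partial>(S \<Otimes>\<^sub>M T)) - 1) / ln b"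
      using f_int R_int int by (simp add: has_bochner_integral_iff)
    also have "\<dots> \<le> integral\<^sup>L (S \<Otimes>\<^sub>M T) ?J"
      using R_le lnb by (simp add: divide_nonpos_pos)
    finally show ?thesis by (simp add: MI)
  qed
qed

text \<open>For a fixed input \<open>x\<close> the output is the noise shifted by
  \<open>g x\<close>, and Lebesgue measure is invariant under shifts. The input coordinate keeps
  \<open>\<mu>\<close> as its reference measure, so no density of the input is required.\<close>

lemma distributed_additive_noise:
  fixes g :: "'a \<Rightarrow> real" and w :: "real \<Rightarrow> ennreal"
  assumes "prob_space \<mu>" and "prob_space (density lborel w)"
    and [measurable]: "g \<in> borel_measurable \<mu>" "w \<in> borel_measurable borel"
  shows "distributed (\<mu> \<Otimes>\<^sub>M density lborel w) (\<mu> \<Otimes>\<^sub>M lborel)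
    (\<lambda>\<omega>. (fst \<omega>, g (fst \<omega>) + snd \<omega>)) (\<lambda>(x, y). w (y - g x))"
  unfolding distributed_def
proof (intro conjI)
  interpret \<mu>: prob_space \<mu> by fact
  interpret N: prob_space "density lborel w" by fact
  interpret P: pair_sigma_finite \<mu> "density lborel w" ..
  interpret Q: pair_sigma_finite \<mu> lborel ..
  let ?t = "\<lambda>\<omega>. (fst \<omega>, g (fst \<omega>) + snd \<omega>)"
  show tm [measurable]: "?t \<in> \<mu> \<Otimes>\<^sub>M density lborel w \<rightarrow>\<^sub>M \<mu> \<Otimes>\<^sub>M lborel"
    by measurable
  show wm [measurable]: "(\<lambda>(x, y). w (y - g x)) \<in> borel_measurable (\<mu> \<Otimes>\<^sub>M lborel)"
    by measurable
  show "distr (\<mu> \<Otimes>\<^sub>M density lborel w) (\<mu> \<Otimes>\<^sub>M lborel) ?t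
    = density (\<mu> \<Otimes>\<^sub>M lborel) (\<lambda>(x, y). w (y - g x))"
  proof (rule measure_eqI)
    fix A assume "A \<in> sets (distr (\<mu> \<Otimes>\<^sub>M density lborel w) (\<mu> \<Otimes>\<^sub>M lborel) ?t)"
    then have A [measurable]: "A \<in> sets (\<mu> \<Otimes>\<^sub>M lborel)" by simp
    have "emeasure (distr (\<mu> \<Otimes>\<^sub>M density lborel w) (\<mu> \<Otimes>\<^sub>M lborel) ?t) A
      = (\<integral>\<^sup>+z. indicator A z \<partial>distr (\<mu> \<Otimes>\<^sub>M density lborel w) (\<mu> \<Otimes>\<^sub>M lborel) ?t)"
      by (rule nn_integral_indicator[symmetric]) (simp only: sets_distr A)
    also have "\<dots> = (\<integral>\<^sup>+\<omega>. indicator A (?t \<omega>) \<partial>(\<mu> \<Otimes>\<^sub>M density lborel w))"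
      by (intro nn_integral_distr) measurable
    also have "\<dots> = (\<integral>\<^sup>+x. \<integral>\<^sup>+z. indicator A (x, g x + z) \<partial>density lborel w \<partial>\<mu>)"
      using N.nn_integral_fst[OF measurable_compose[OF tm borel_measurable_indicator[OF A]]] by simp
    also have "\<dots> = (\<integral>\<^sup>+x. \<integral>\<^sup>+y. w (y - g x) * indicator A (x, y) \<partial>lborel \<partial>\<mu>)"
    proof (rule nn_integral_cong)
      fix x assume [measurable]: "x \<in> space \<mu>"
      have "(\<integral>\<^sup>+z. indicator A (x, g x + z) \<partial>density lborel w)
        = (\<integral>\<^sup>+z. w z * indicator A (x, g x + z) \<partial>lborel)"
        by (subst nn_integral_density) auto
      also have "\<dots> = (\<integral>\<^sup>+y. w (y - g x) * indicator A (x, y) \<partial>lborel)"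
        using nn_integral_real_affine[of "\<lambda>y. w (y - g x) * indicator A (x, y)" 1 "g x"] by simp
      finally show "(\<integral>\<^sup>+z. indicator A (x, g x + z) \<partial>density lborel w)
        = (\<integral>\<^sup>+y. w (y - g x) * indicator A (x, y) \<partial>lborel)" .
    qed
    also have "\<dots> = (\<integral>\<^sup>+z. (case z of (x, y) \<Rightarrow> w (y - g x)) * indicator A z \<partial>(\<mu> \<Otimes>\<^sub>M lborel))"
    proof -
      have "(\<lambda>z. (case z of (x, y) \<Rightarrow> w (y - g x)) * indicator A z) \<in> borel_measurable (\<mu> \<Otimes>\<^sub>M lborel)"
        using A by measurable
      from lborel.nn_integral_fst[OF this] show ?thesis by simp
    qed
    also have "\<dots> = emeasure (density (\<mu> \<Otimes>\<^sub>M lborel) (\<lambda>(x, y). w (y - g x))) A"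
      by (rule emeasure_density[OF wm A, symmetric])
    finally show "emeasure (distr (\<mu> \<Otimes>\<^sub>M density lborel w) (\<mu> \<Otimes>\<^sub>M lborel) ?t) A
      = emeasure (density (\<mu> \<Otimes>\<^sub>M lborel) (\<lambda>(x, y). w (y - g x))) A" .
  qed simp
qed

subsection \<open>Truncated Gaussian moments\<close>

lemma integrable_normal_density_square:
  assumes "0 < \<sigma>"
  shows "integrable lborel (\<lambda>y. normal_density \<mu> \<sigma> y * (y - a)\<^sup>2)"
proof -
  have "integrable lborel (\<lambda>y. normal_density \<mu> \<sigma> y * (y - \<mu>)\<^sup>2
    + 2 * (\<mu> - a) * (normal_density \<mu> \<sigma> y * (y - \<mu>) ^ 1)
    + (\<mu> - a)\<^sup>2 * normal_density \<mu> \<sigma> y)"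
    using assms by (intro Bochner_Integration.integrable_add integrable_mult_right
        integrable_normal_moment integrable_normal_density)
  also have "(\<lambda>y. normal_density \<mu> \<sigma> y * (y - \<mu>)\<^sup>2
    + 2 * (\<mu> - a) * (normal_density \<mu> \<sigma> y * (y - \<mu>) ^ 1)
    + (\<mu> - a)\<^sup>2 * normal_density \<mu> \<sigma> y) = (\<lambda>y. normal_density \<mu> \<sigma> y * (y - a)\<^sup>2)"
    by (rule ext) (simp add: power2_eq_square algebra_simps)
  finally show ?thesis .
qed

lemma integrable_normal_density_square_indicator:
  assumes "0 < \<sigma>" and [measurable]: "A \<in> sets borel"
  shows "integrable lborel (\<lambda>y. normal_density \<mu> \<sigma> y * (((y - a)\<^sup>2 - \<sigma>\<^sup>2) * indicator A y))"
proof -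
  have "integrable lborel (\<lambda>y. (normal_density \<mu> \<sigma> y * (y - a)\<^sup>2
      - \<sigma>\<^sup>2 * normal_density \<mu> \<sigma> y) * indicator A y)"
    using assms by (intro integrable_real_mult_indicator Bochner_Integration.integrable_diff
        integrable_mult_right integrable_normal_density_square integrable_normal_density) auto
  then show ?thesis by (simp add: algebra_simps)
qed

text \<open>The integrand is even, so each half line contributes half of the integral over the whole
  line, and that is the variance minus \<open>\<sigma>\<^sup>2\<close>.\<close>

lemma normal_second_moment_half_line:
  assumes "0 < \<sigma>"
  shows "(\<integral>y. normal_density 0 \<sigma> y * ((y\<^sup>2 - \<sigma>\<^sup>2) * indicator {..<0} y) \<partial>lborel) = 0"
proof -
  let ?g = "\<lambda>y. normal_density 0 \<sigma> y * (y\<^sup>2 - \<sigma>\<^sup>2)"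
  let ?I = "\<lambda>A. \<integral>y. normal_density 0 \<sigma> y * ((y\<^sup>2 - \<sigma>\<^sup>2) * indicator A y) \<partial>lborel"
  have int: "integrable lborel (\<lambda>y. normal_density 0 \<sigma> y * ((y\<^sup>2 - \<sigma>\<^sup>2) * indicator A y))"
    if "A \<in> sets borel" for A
    using integrable_normal_density_square_indicator[OF assms that, of 0 0] by simp
  have "?I {..<0} = ?I {0<..}"
    by (subst lborel_integral_real_affine[where c = "-1" and t = 0])
      (auto simp: normal_density_def indicator_def intro!: Bochner_Integration.integral_cong)
  moreover have "?I {..<0} + ?I {0<..} = (\<integral>y. ?g y \<partial>lborel)"
  proof -
    have "?I {..<0} + ?I {0<..} = (\<integral>y. normal_density 0 \<sigma> y * ((y\<^sup>2 - \<sigma>\<^sup>2) * indicator {..<0} y)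
      + normal_density 0 \<sigma> y * ((y\<^sup>2 - \<sigma>\<^sup>2) * indicator {0<..} y) \<partial>lborel)"
      using int by simp
    also have "\<dots> = (\<integral>y. ?g y \<partial>lborel)"
    proof (rule integral_cong_AE)
      show "AE y in lborel. normal_density 0 \<sigma> y * ((y\<^sup>2 - \<sigma>\<^sup>2) * indicator {..<0} y)
        + normal_density 0 \<sigma> y * ((y\<^sup>2 - \<sigma>\<^sup>2) * indicator {0<..} y) = ?g y"
        using AE_lborel_singleton[of 0] by eventually_elim (auto simp: indicator_def)
    qed measurable
    finally show ?thesis .
  qed
  moreover have "(\<integral>y. ?g y \<partial>lborel) = 0"
    using integral_normal_moment_even[OF assms, of 0 1] assms
      integrable_normal_moment[OF assms, of 0 2]
    by (simp add: right_diff_distrib fact_numeral)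
  ultimately show ?thesis by simp
qed

text \<open>Relative to the density centred at \<open>0\<close>, the density centred at \<open>s \<ge> 0\<close> carries the
  factor \<open>exp (s y / \<sigma>\<^sup>2)\<close>, which is increasing, while \<open>y\<^sup>2 - \<sigma>\<^sup>2\<close> changes sign from positive to
  negative at \<open>- \<sigma>\<close>: comparing with the value of the factor at \<open>- \<sigma>\<close> reduces to \<open>s = 0\<close>.\<close>

lemma normal_lower_tail_le:
  assumes "0 < \<sigma>" "0 \<le> s"
  shows "(\<integral>y. normal_density s \<sigma> y * ((y\<^sup>2 - \<sigma>\<^sup>2) * indicator {..<0} y) \<partial>lborel) \<le> 0"
proof -
  \<comment> \<open>Expanding \<open>(y - s)\<^sup>2\<close> splits the exponent into the density
    centred at 0, the factor in \<open>s * y\<close>, and this part independent of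
    \<open>y\<close>.\<close>
  define c where "c = exp (- (s\<^sup>2 / (2 * \<sigma>\<^sup>2)))"
  have dens: "normal_density s \<sigma> y = c * exp (s * y / \<sigma>\<^sup>2) * normal_density 0 \<sigma> y" for y
  proof -
    have "- (y - s)\<^sup>2 / (2 * \<sigma>\<^sup>2) = - (s\<^sup>2 / (2 * \<sigma>\<^sup>2)) + s * y / \<sigma>\<^sup>2 + - y\<^sup>2 / (2 * \<sigma>\<^sup>2)"
      using assms by (simp add: field_simps power2_eq_square)
    then show ?thesis
      by (simp add: normal_density_def c_def exp_add[symmetric] algebra_simps)
  qed
  have "(\<integral>y. normal_density s \<sigma> y * ((y\<^sup>2 - \<sigma>\<^sup>2) * indicator {..<0} y) \<partial>lborel)
    \<le> (\<integral>y. c * exp (- s / \<sigma>) * (normal_density 0 \<sigma> y * ((y\<^sup>2 - \<sigma>\<^sup>2) * indicator {..<0} y)) \<partial>lborel)"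
  proof (rule integral_mono)
    show "integrable lborel (\<lambda>y. normal_density s \<sigma> y * ((y\<^sup>2 - \<sigma>\<^sup>2) * indicator {..<0} y))"
      using integrable_normal_density_square_indicator[OF assms(1), of "{..<0}" s 0] by simp
    show "integrable lborel (\<lambda>y. c * exp (- s / \<sigma>)
        * (normal_density 0 \<sigma> y * ((y\<^sup>2 - \<sigma>\<^sup>2) * indicator {..<0} y)))"
      using integrable_normal_density_square_indicator[OF assms(1), of "{..<0}" 0 0]
      by (intro integrable_mult_right) simp
    fix y :: real
    have "exp (s * y / \<sigma>\<^sup>2) * (y\<^sup>2 - \<sigma>\<^sup>2) \<le> exp (- s / \<sigma>) * (y\<^sup>2 - \<sigma>\<^sup>2)" if "y < 0"
    proof (cases "y \<le> - \<sigma>")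
      case True
      then have "s * y / \<sigma>\<^sup>2 \<le> s * (- \<sigma>) / \<sigma>\<^sup>2"
        using assms by (intro divide_right_mono mult_left_mono) auto
      also have "\<dots> = - s / \<sigma>" by (simp add: power2_eq_square)
      finally have "exp (s * y / \<sigma>\<^sup>2) \<le> exp (- s / \<sigma>)" by simp
      moreover have "\<sigma>\<^sup>2 \<le> y\<^sup>2" using True assms power_mono[of \<sigma> "- y" 2] by simp
      ultimately show ?thesis by (intro mult_right_mono) auto
    next
      case False
      then have "s * (- \<sigma>) / \<sigma>\<^sup>2 \<le> s * y / \<sigma>\<^sup>2"
        using assms by (intro divide_right_mono mult_left_mono) auto
      moreover have "s * (- \<sigma>) / \<sigma>\<^sup>2 = - s / \<sigma>" by (simp add: power2_eq_square)
      ultimately have "exp (- s / \<sigma>) \<le> exp (s * y / \<sigma>\<^sup>2)" by simp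
      moreover have "y\<^sup>2 \<le> \<sigma>\<^sup>2" using False \<open>y < 0\<close> power_mono[of "- y" \<sigma> 2] by simp
      ultimately show ?thesis by (intro mult_right_mono_neg) auto
    qed
    moreover have "0 \<le> c * normal_density 0 \<sigma> y" by (simp add: c_def)
    ultimately have "y < 0 \<Longrightarrow> (c * normal_density 0 \<sigma> y) * (exp (s * y / \<sigma>\<^sup>2) * (y\<^sup>2 - \<sigma>\<^sup>2))
      \<le> (c * normal_density 0 \<sigma> y) * (exp (- s / \<sigma>) * (y\<^sup>2 - \<sigma>\<^sup>2))"
      by (intro mult_left_mono) auto
    then show "normal_density s \<sigma> y * ((y\<^sup>2 - \<sigma>\<^sup>2) * indicator {..<0} y)
      \<le> c * exp (- s / \<sigma>) * (normal_density 0 \<sigma> y * ((y\<^sup>2 - \<sigma>\<^sup>2) * indicator {..<0} y))"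
      by (simp add: dens indicator_def mult_ac)
  qed
  also have "\<dots> = 0" using normal_second_moment_half_line[OF assms(1)] by simp
  finally show ?thesis .
qed

text \<open>The reflection of \<open>y\<close> to \<open>a - y\<close> turns this into the lower
  tail of a Gaussian centred at \<open>a - s \<ge> 0\<close>.\<close>

lemma normal_upper_tail_le:
  assumes "0 < \<sigma>" "s \<le> a"
  shows "(\<integral>y. normal_density s \<sigma> y * (((y - a)\<^sup>2 - \<sigma>\<^sup>2) * indicator {a<..} y) \<partial>lborel) \<le> 0"
proof -
  have "(\<integral>y. normal_density s \<sigma> y * (((y - a)\<^sup>2 - \<sigma>\<^sup>2) * indicator {a<..} y) \<partial>lborel)
    = (\<integral>y. normal_density (a - s) \<sigma> y * ((y\<^sup>2 - \<sigma>\<^sup>2) * indicator {..<0} y) \<partial>lborel)"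
    by (subst lborel_integral_real_affine[where c = "-1" and t = a])
      (auto simp: normal_density_def indicator_def power2_commute algebra_simps
        intro!: Bochner_Integration.integral_cong)
  also have "\<dots> \<le> 0"
    using assms by (intro normal_lower_tail_le) auto
  finally show ?thesis .
qed

text \<open>The function \<open>- \<sigma>\<^sup>2 * normal_density s \<sigma> y\<close> is an
  antiderivative of the integrand on the interval.\<close>

lemma normal_first_moment_Icc:
  assumes "0 < \<sigma>" "c \<le> b"
  shows "has_bochner_integral lborel
    (\<lambda>y. normal_density s \<sigma> y * ((y - s) * indicator {c..b} y))
    (\<sigma>\<^sup>2 * (normal_density s \<sigma> c - normal_density s \<sigma> b))"
proof -
  define C where "C = 1 / sqrt (2 * pi * \<sigma>\<^sup>2)"
  have dens: "normal_density s \<sigma> = (\<lambda>y. C * exp (- (y - s)\<^sup>2 / (2 * \<sigma>\<^sup>2)))"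
    by (rule ext) (simp add: normal_density_def C_def)
  have "has_bochner_integral lborel
    (\<lambda>y. (normal_density s \<sigma> y * (y - s)) * indicator {c..b} y)
    (- \<sigma>\<^sup>2 * normal_density s \<sigma> b - (- \<sigma>\<^sup>2 * normal_density s \<sigma> c))"
  proof (rule has_bochner_integral_FTC_Icc_real)
    fix y
    show "((\<lambda>y. - \<sigma>\<^sup>2 * normal_density s \<sigma> y) has_real_derivative
      normal_density s \<sigma> y * (y - s)) (at y)"
      unfolding dens
      using assms by (auto intro!: derivative_eq_intros simp: field_simps power2_eq_square)
    show "isCont (\<lambda>y. normal_density s \<sigma> y * (y - s)) y"
      unfolding normal_density_def using assms by (auto intro!: continuous_intros)
  qed fact
  then show ?thesis by (simp add: algebra_simps)
qed

text \<open>In the exact value, the exponential at \<open>c\<close> is at most 1, and the one at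
  \<open>b\<close> is smallest for \<open>s = 0\<close> because
  \<open>0 \<le> b - s \<le> b\<close>. The resulting bound depends on neither \<open>s\<close> nor
  \<open>c\<close>, so one constant serves all inputs and all thresholds.\<close>

lemma normal_first_moment_Icc_le:
  assumes "0 < \<sigma>" "c \<le> b" "0 \<le> s" "s \<le> b"
  shows "(\<integral>y. normal_density s \<sigma> y * ((y - s) * indicator {c..b} y) \<partial>lborel)
    \<le> \<sigma> / sqrt (2 * pi) * (1 - exp (- (b\<^sup>2 / (2 * \<sigma>\<^sup>2))))"
proof -
  have "(\<integral>y. normal_density s \<sigma> y * ((y - s) * indicator {c..b} y) \<partial>lborel)
    = \<sigma>\<^sup>2 * (normal_density s \<sigma> c - normal_density s \<sigma> b)"
    using normal_first_moment_Icc[OF assms(1,2)] by (rule has_bochner_integral_integral_eq)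
  also have "\<dots> = \<sigma> / sqrt (2 * pi)
      * (exp (- (c - s)\<^sup>2 / (2 * \<sigma>\<^sup>2)) - exp (- (b - s)\<^sup>2 / (2 * \<sigma>\<^sup>2)))"
  proof -
    have "\<sigma>\<^sup>2 * (1 / (sqrt (2 * pi) * \<sigma>) * u - 1 / (sqrt (2 * pi) * \<sigma>) * v)
      = \<sigma> / sqrt (2 * pi) * (u - v)" for u v
      using assms(1) by (simp add: field_simps power2_eq_square)
    then show ?thesis
      using assms(1) by (simp only: normal_density_def real_sqrt_mult[of _ "\<sigma>\<^sup>2"]) simp
  qed
  also have "\<dots> \<le> \<sigma> / sqrt (2 * pi) * (1 - exp (- (b\<^sup>2 / (2 * \<sigma>\<^sup>2))))"
  proof (intro mult_left_mono diff_mono)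
    have "(b - s)\<^sup>2 \<le> b\<^sup>2" using assms by (intro power_mono) auto
    then show "exp (- (b\<^sup>2 / (2 * \<sigma>\<^sup>2))) \<le> exp (- (b - s)\<^sup>2 / (2 * \<sigma>\<^sup>2))"
      using assms(1) by (simp add: divide_right_mono)
  qed (use assms(1) in auto)
  finally show ?thesis .
qed

subsection \<open>Reference density with Gaussian tails\<close>

text \<open>Each tail is a Gaussian exponent lowered by \<open>1 / 2\<close>. The shift makes the
  tails average to at most 0 against a Gaussian centred in \<open>[0, a]\<close>, at the price of a
  factor \<open>sqrt (exp 1)\<close> in the mass of \<open>exp (- L)\<close>; this is the origin of
  the \<open>exp 1\<close> under the root in the final bound.\<close>

definition gauss_tails :: "real \<Rightarrow> real \<Rightarrow> (real \<Rightarrow> real) \<Rightarrow> real \<Rightarrow> real" where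
  "gauss_tails \<sigma> a \<psi> y =
     (if y < 0 then (y\<^sup>2 - \<sigma>\<^sup>2) / (2 * \<sigma>\<^sup>2)
      else if a < y then ((y - a)\<^sup>2 - \<sigma>\<^sup>2) / (2 * \<sigma>\<^sup>2)
      else \<psi> y)"

lemma borel_measurable_gauss_tails [measurable]:
  assumes [measurable]: "\<psi> \<in> borel_measurable borel"
  shows "gauss_tails \<sigma> a \<psi> \<in> borel_measurable borel"
  unfolding gauss_tails_def[abs_def] by measurable

text \<open>Both tails are halves of Gaussian bells with the same peak, one cut at its centre 0 and
  the other at its centre \<open>a\<close>. Moved together they form one full bell of mass
  \<open>sqrt (2 * pi * exp 1) * \<sigma>\<close>; the middle contributes the integral of
  \<open>exp (- \<psi> y)\<close>.\<close>

lemma has_bochner_integral_exp_gauss_tails: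
  assumes \<sigma>: "0 < \<sigma>" and a: "0 \<le> a" and \<psi>: "continuous_on {0..a} \<psi>"
  shows "has_bochner_integral lborel (\<lambda>y. exp (- gauss_tails \<sigma> a \<psi> y))
    (integral {0..a} (\<lambda>y. exp (- \<psi> y)) + sqrt (2 * pi * exp 1) * \<sigma>)"
proof -
  define C where "C = sqrt (2 * pi * exp 1) * \<sigma>"
  have peak: "C * normal_density m \<sigma> y = exp (- (((y - m)\<^sup>2 - \<sigma>\<^sup>2) / (2 * \<sigma>\<^sup>2)))" for m y
  proof -
    have "- (((y - m)\<^sup>2 - \<sigma>\<^sup>2) / (2 * \<sigma>\<^sup>2)) = 1 / 2 + - (y - m)\<^sup>2 / (2 * \<sigma>\<^sup>2)"
      using \<sigma> by (simp add: field_simps)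
    then have "exp (- (((y - m)\<^sup>2 - \<sigma>\<^sup>2) / (2 * \<sigma>\<^sup>2)))
      = exp (1 / 2) * exp (- (y - m)\<^sup>2 / (2 * \<sigma>\<^sup>2))"
      by (simp only: exp_add)
    moreover have "sqrt (exp 1) = exp (1 / 2 :: real)"
      by (rule real_sqrt_unique) (auto simp: exp_double[symmetric])
    ultimately show ?thesis
      using \<sigma> by (simp add: C_def normal_density_def real_sqrt_mult)
  qed
  have mid: "has_bochner_integral lborel (\<lambda>y. indicator {0..a} y *\<^sub>R exp (- \<psi> y))
    (integral {0..a} (\<lambda>y. exp (- \<psi> y)))"
  proof -
    have "set_integrable lborel {0..a} (\<lambda>y. exp (- \<psi> y))"
      by (rule borel_integrable_atLeastAtMost') (intro continuous_intros \<psi>)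
    then show ?thesis
      using set_borel_integral_eq_integral(2)[of "{0..a}" "\<lambda>y. exp (- \<psi> y)"]
      by (simp add: has_bochner_integral_iff set_integrable_def set_lebesgue_integral_def)
  qed
  have half: "integrable lborel (\<lambda>y. normal_density m \<sigma> y * indicator A y)"
    if "A \<in> sets borel" for m A
    using \<sigma> that by (intro integrable_real_mult_indicator) auto
  have "(\<integral>y. normal_density a \<sigma> y * indicator {a<..} y \<partial>lborel)
    = (\<integral>y. normal_density 0 \<sigma> y * indicator {0<..} y \<partial>lborel)"
    by (subst lborel_integral_real_affine[where c = 1 and t = a])
      (auto simp: normal_density_def indicator_def intro!: Bochner_Integration.integral_cong)
  moreover have "(\<integral>y. normal_density 0 \<sigma> y * indicator {..<0} y \<partial>lborel)
      + (\<integral>y. normal_density 0 \<sigma> y * indicator {0<..} y \<partial>lborel)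
    = (\<integral>y. normal_density 0 \<sigma> y \<partial>lborel)"
  proof -
    have "(\<integral>y. normal_density 0 \<sigma> y * indicator {..<0} y \<partial>lborel)
      + (\<integral>y. normal_density 0 \<sigma> y * indicator {0<..} y \<partial>lborel)
      = (\<integral>y. normal_density 0 \<sigma> y * indicator {..<0} y
          + normal_density 0 \<sigma> y * indicator {0<..} y \<partial>lborel)"
      using half by simp
    also have "\<dots> = (\<integral>y. normal_density 0 \<sigma> y \<partial>lborel)"
    proof (rule integral_cong_AE)
      show "AE y in lborel. normal_density 0 \<sigma> y * indicator {..<0} y
        + normal_density 0 \<sigma> y * indicator {0<..} y = normal_density 0 \<sigma> y"
        using AE_lborel_singleton[of 0] by eventually_elim (auto simp: indicator_def)
    qed measurable
    finally show ?thesis .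
  qed
  ultimately have tails: "(\<integral>y. normal_density 0 \<sigma> y * indicator {..<0} y \<partial>lborel)
      + (\<integral>y. normal_density a \<sigma> y * indicator {a<..} y \<partial>lborel) = 1"
    using \<sigma> by simp
  have "has_bochner_integral lborel (\<lambda>y. indicator {0..a} y *\<^sub>R exp (- \<psi> y)
      + C * (normal_density 0 \<sigma> y * indicator {..<0} y + normal_density a \<sigma> y * indicator {a<..} y))
    (integral {0..a} (\<lambda>y. exp (- \<psi> y)) + C * 1)"
    using half tails
    by (intro has_bochner_integral_add mid has_bochner_integral_mult_right)
      (auto simp: has_bochner_integral_iff)
  also have "(\<lambda>y. indicator {0..a} y *\<^sub>R exp (- \<psi> y)
      + C * (normal_density 0 \<sigma> y * indicator {..<0} y + normal_density a \<sigma> y * indicator {a<..} y))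
    = (\<lambda>y. exp (- gauss_tails \<sigma> a \<psi> y))"
    using a peak[of 0] peak[of a]
    by (intro ext) (auto simp: gauss_tails_def indicator_def)
  finally show ?thesis by (simp add: C_def)
qed

text \<open>A point outside \<open>[0, a]\<close> is at least as far from \<open>s\<close> as from
  the nearer endpoint, so the tails are dominated by a quadratic centred at \<open>s\<close>. This
  gives integrability against the Gaussian at \<open>s\<close>, with constants uniform in
  \<open>s\<close>.\<close>

lemma abs_gauss_tails_le:
  assumes "0 < \<sigma>" "0 \<le> s" "s \<le> a" and "\<And>y. 0 \<le> y \<Longrightarrow> y \<le> a \<Longrightarrow> \<bar>\<psi> y\<bar> \<le> B"
  shows "\<bar>gauss_tails \<sigma> a \<psi> y\<bar> \<le> \<bar>B\<bar> + 1 / 2 + (y - s)\<^sup>2 / (2 * \<sigma>\<^sup>2)"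
proof -
  have quad: "\<bar>(u - \<sigma>\<^sup>2) / (2 * \<sigma>\<^sup>2)\<bar> \<le> \<bar>B\<bar> + 1 / 2 + v / (2 * \<sigma>\<^sup>2)" if "0 \<le> u" "u \<le> v" for u v
  proof -
    have "(u - \<sigma>\<^sup>2) / (2 * \<sigma>\<^sup>2) = u / (2 * \<sigma>\<^sup>2) - 1 / 2" using assms(1) by (simp add: field_simps)
    moreover have "0 \<le> u / (2 * \<sigma>\<^sup>2)" "u / (2 * \<sigma>\<^sup>2) \<le> v / (2 * \<sigma>\<^sup>2)"
      using that by (auto intro: divide_right_mono)
    ultimately show ?thesis by linarith
  qed
  have "y\<^sup>2 \<le> (y - s)\<^sup>2" if "y < 0"
    using that assms by (simp add: abs_le_square_iff[symmetric])
  moreover have "(y - a)\<^sup>2 \<le> (y - s)\<^sup>2" if "a < y"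
    using that assms by (simp add: abs_le_square_iff[symmetric])
  moreover have "0 \<le> (y - s)\<^sup>2 / (2 * \<sigma>\<^sup>2)" by simp
  moreover have "\<bar>\<psi> y\<bar> \<le> \<bar>B\<bar> + 1 / 2 + (y - s)\<^sup>2 / (2 * \<sigma>\<^sup>2)" if "0 \<le> y" "y \<le> a"
    using assms(4)[OF that] \<open>0 \<le> (y - s)\<^sup>2 / (2 * \<sigma>\<^sup>2)\<close> by linarith
  ultimately show ?thesis
    using quad by (simp add: gauss_tails_def)
qed

lemma integrable_normal_gauss_tails:
  assumes \<sigma>: "0 < \<sigma>" "0 \<le> s" "s \<le> a"
    and \<psi>: "\<And>y. 0 \<le> y \<Longrightarrow> y \<le> a \<Longrightarrow> \<bar>\<psi> y\<bar> \<le> B"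
    and [measurable]: "\<psi> \<in> borel_measurable borel"
  shows "integrable lborel (\<lambda>y. normal_density s \<sigma> y * gauss_tails \<sigma> a \<psi> y)"
proof (rule Bochner_Integration.integrable_bound)
  show "integrable lborel (\<lambda>y. (\<bar>B\<bar> + 1 / 2) * normal_density s \<sigma> y
      + 1 / (2 * \<sigma>\<^sup>2) * (normal_density s \<sigma> y * (y - s)\<^sup>2))"
    using \<sigma>(1) by (intro Bochner_Integration.integrable_add integrable_mult_right
        integrable_normal_density integrable_normal_density_square)
  show "AE y in lborel. norm (normal_density s \<sigma> y * gauss_tails \<sigma> a \<psi> y)
    \<le> norm ((\<bar>B\<bar> + 1 / 2) * normal_density s \<sigma> y
      + 1 / (2 * \<sigma>\<^sup>2) * (normal_density s \<sigma> y * (y - s)\<^sup>2))"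
  proof (rule AE_I2)
    fix y
    have "norm (normal_density s \<sigma> y * gauss_tails \<sigma> a \<psi> y)
      \<le> normal_density s \<sigma> y * (\<bar>B\<bar> + 1 / 2 + (y - s)\<^sup>2 / (2 * \<sigma>\<^sup>2))"
      using abs_gauss_tails_le[OF \<sigma> \<psi>] by (simp add: abs_mult mult_left_mono)
    also have "\<dots> = (\<bar>B\<bar> + 1 / 2) * normal_density s \<sigma> y
      + 1 / (2 * \<sigma>\<^sup>2) * (normal_density s \<sigma> y * (y - s)\<^sup>2)"
      by (simp add: algebra_simps)
    finally show "norm (normal_density s \<sigma> y * gauss_tails \<sigma> a \<psi> y)
      \<le> norm ((\<bar>B\<bar> + 1 / 2) * normal_density s \<sigma> y
        + 1 / (2 * \<sigma>\<^sup>2) * (normal_density s \<sigma> y * (y - s)\<^sup>2))"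
      by simp
  qed
qed measurable

lemma pos_part_nonneg: "0 \<le> pos_part u"
  by (simp add: pos_part_def)

lemma borel_measurable_pos_part [measurable]: "pos_part \<in> borel_measurable borel"
  unfolding pos_part_def[abs_def] by measurable

text \<open>On \<open>[0, a]\<close> the bound
  \<open>(y - c)\<^sub>+ \<le> (s - c)\<^sub>+ + (y - s)\<close> for \<open>y \<ge> c\<close>
  reduces each summand to a constant plus a truncated first moment. The Gaussian tails contribute
  nothing positive.\<close>

lemma integral_normal_gauss_tails_le:
  fixes w c :: "'i \<Rightarrow> real"
  assumes \<sigma>: "0 < \<sigma>" and s: "0 \<le> s" "s \<le> a"
    and w: "\<And>i. i \<in> I \<Longrightarrow> 0 \<le> w i" and c: "\<And>i. i \<in> I \<Longrightarrow> 0 \<le> c i \<and> c i \<le> a"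
    and int: "integrable lborel (\<lambda>y. normal_density s \<sigma> y
      * gauss_tails \<sigma> a (\<lambda>y. \<Sum>i\<in>I. w i * pos_part (y - c i)) y)"
  shows "(\<integral>y. normal_density s \<sigma> y
      * gauss_tails \<sigma> a (\<lambda>y. \<Sum>i\<in>I. w i * pos_part (y - c i)) y \<partial>lborel)
    \<le> (\<Sum>i\<in>I. w i * pos_part (s - c i))
      + (\<Sum>i\<in>I. w i * \<sigma> / sqrt (2 * pi) * (1 - exp (- (a\<^sup>2 / (2 * \<sigma>\<^sup>2)))))"
proof -
  let ?\<psi> = "\<lambda>y. \<Sum>i\<in>I. w i * pos_part (y - c i)"
  let ?M = "\<lambda>i y. normal_density s \<sigma> y * ((y - s) * indicator {c i..a} y)"
  let ?L = "\<lambda>y. normal_density s \<sigma> y * ((y\<^sup>2 - \<sigma>\<^sup>2) * indicator {..<0} y)"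
  let ?U = "\<lambda>y. normal_density s \<sigma> y * (((y - a)\<^sup>2 - \<sigma>\<^sup>2) * indicator {a<..} y)"
  have intM: "integrable lborel (?M i)" if "i \<in> I" for i
    using normal_first_moment_Icc[OF \<sigma>, of "c i" a s] c[OF that]
    by (auto simp: has_bochner_integral_iff)
  have intL: "integrable lborel ?L"
    using integrable_normal_density_square_indicator[OF \<sigma>, of "{..<0}" s 0] by simp
  have intU: "integrable lborel ?U"
    using integrable_normal_density_square_indicator[OF \<sigma>, of "{a<..}" s a] by simp
  have "(\<integral>y. normal_density s \<sigma> y * gauss_tails \<sigma> a ?\<psi> y \<partial>lborel)
    \<le> (\<integral>y. ?\<psi> s * normal_density s \<sigma> y + (\<Sum>i\<in>I. w i * ?M i y)
        + 1 / (2 * \<sigma>\<^sup>2) * (?L y + ?U y) \<partial>lborel)"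
  proof (rule integral_mono[OF int])
    show "integrable lborel (\<lambda>y. ?\<psi> s * normal_density s \<sigma> y + (\<Sum>i\<in>I. w i * ?M i y)
        + 1 / (2 * \<sigma>\<^sup>2) * (?L y + ?U y))"
      using intM intL intU \<sigma>
      by (intro Bochner_Integration.integrable_add integrable_mult_right
          Bochner_Integration.integrable_sum integrable_normal_density)
    fix y
    define D where "D = (\<Sum>i\<in>I. w i * ((y - s) * indicator {c i..a} y))"
    have "w i * pos_part (y - c i) \<le> w i * pos_part (s - c i) + w i * ((y - s) * indicator {c i..a} y)"
      if "i \<in> I" "0 \<le> y" "y \<le> a" for i
      unfolding distrib_left[symmetric]
      by (rule mult_left_mono) (use that w in \<open>auto simp: pos_part_def indicator_def\<close>)
    then have mid: "?\<psi> y \<le> ?\<psi> s + D"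
      if "0 \<le> y" "y \<le> a"
      using that by (simp add: D_def sum.distrib[symmetric] sum_mono)
    \<comment> \<open>The corrections vanish outside \<open>[0, a]\<close> since every
      \<open>[c i, a]\<close> lies inside it. The constant \<open>?\<psi> s\<close> is nonnegative
      and may stay there, so that it integrates against the full Gaussian mass 1.\<close>
    have out: "0 \<le> ?\<psi> s + D"
      if "y < 0 \<or> a < y"
    proof -
      have "D = 0"
        unfolding D_def by (rule sum.neutral) (use that c in \<open>force simp: indicator_def\<close>)
      then show ?thesis using w by (simp add: sum_nonneg pos_part_nonneg)
    qed
    have "gauss_tails \<sigma> a ?\<psi> y \<le> ?\<psi> s + D
      + 1 / (2 * \<sigma>\<^sup>2) * ((y\<^sup>2 - \<sigma>\<^sup>2) * indicator {..<0} y + ((y - a)\<^sup>2 - \<sigma>\<^sup>2) * indicator {a<..} y)"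
      using mid out s by (simp add: gauss_tails_def indicator_def)
    then have "normal_density s \<sigma> y * gauss_tails \<sigma> a ?\<psi> y
      \<le> normal_density s \<sigma> y * (?\<psi> s + D
      + 1 / (2 * \<sigma>\<^sup>2) * ((y\<^sup>2 - \<sigma>\<^sup>2) * indicator {..<0} y + ((y - a)\<^sup>2 - \<sigma>\<^sup>2) * indicator {a<..} y))"
      by (rule mult_left_mono) simp
    also have "\<dots> = ?\<psi> s * normal_density s \<sigma> y + (\<Sum>i\<in>I. w i * ?M i y)
        + 1 / (2 * \<sigma>\<^sup>2) * (?L y + ?U y)"
      by (simp only: D_def distrib_left sum_distrib_left mult_ac)
    finally show "normal_density s \<sigma> y * gauss_tails \<sigma> a ?\<psi> y
      \<le> ?\<psi> s * normal_density s \<sigma> y + (\<Sum>i\<in>I. w i * ?M i y) + 1 / (2 * \<sigma>\<^sup>2) * (?L y + ?U y)" .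
  qed
  also have "\<dots> = ?\<psi> s + (\<Sum>i\<in>I. w i * integral\<^sup>L lborel (?M i))
    + 1 / (2 * \<sigma>\<^sup>2) * (integral\<^sup>L lborel ?L + integral\<^sup>L lborel ?U)"
    using intM intL intU \<sigma> by simp
  also have "\<dots> \<le> ?\<psi> s + (\<Sum>i\<in>I. w i * (\<sigma> / sqrt (2 * pi) * (1 - exp (- (a\<^sup>2 / (2 * \<sigma>\<^sup>2)))))) + 0"
  proof (intro add_mono sum_mono mult_left_mono order_refl)
    show "integral\<^sup>L lborel (?M i) \<le> \<sigma> / sqrt (2 * pi) * (1 - exp (- (a\<^sup>2 / (2 * \<sigma>\<^sup>2))))"
      if "i \<in> I" for i
      using normal_first_moment_Icc_le[OF \<sigma> _ s] c[OF that] by simp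
    show "1 / (2 * \<sigma>\<^sup>2) * (integral\<^sup>L lborel ?L + integral\<^sup>L lborel ?U) \<le> 0"
      using normal_lower_tail_le[OF \<sigma> s(1)] normal_upper_tail_le[OF \<sigma> s(2)]
      by (intro mult_nonneg_nonpos) auto
  qed (use w in auto)
  finally show ?thesis by (simp add: mult.assoc)
qed

subsection \<open>The bound for a single input law\<close>

text \<open>The dual bound with \<open>r\<close> the normalised \<open>exp (- L)\<close>. Given an
  input with \<open>s = g x\<close>, the divergence splits into normalising constants, the Gaussian
  quadratic term with mean \<open>1 / 2\<close>, and the average of \<open>L\<close>, which is then
  averaged over the input.\<close>

lemma gaussian_channel_information_le:
  fixes g :: "'a \<Rightarrow> real" and w c :: "'i \<Rightarrow> real"
  assumes \<mu>: "prob_space \<mu>" and \<sigma>: "0 < \<sigma>" and a: "0 \<le> a"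
    and gm [measurable]: "g \<in> borel_measurable \<mu>" and g: "AE x in \<mu>. 0 \<le> g x \<and> g x \<le> a"
    and w: "\<And>i. i \<in> I \<Longrightarrow> 0 \<le> w i" and c: "\<And>i. i \<in> I \<Longrightarrow> 0 \<le> c i \<and> c i \<le> a"
  shows "prob_space.mutual_information (\<mu> \<Otimes>\<^sub>M density lborel (normal_density 0 \<sigma>)) (exp 1)
      \<mu> lborel fst (\<lambda>\<omega>. g (fst \<omega>) + snd \<omega>)
    \<le> ln (1 + integral {0..a} (\<lambda>y. exp (- (\<Sum>i\<in>I. w i * pos_part (y - c i))))
          / (sqrt (2 * pi * exp 1) * \<sigma>))
      + (\<Sum>i\<in>I. w i * (\<integral>x. pos_part (g x - c i) \<partial>\<mu>))
      + (\<Sum>i\<in>I. w i * \<sigma> / sqrt (2 * pi) * (1 - exp (- (a\<^sup>2 / (2 * \<sigma>\<^sup>2)))))"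
proof -
  define \<psi> where "\<psi> y = (\<Sum>i\<in>I. w i * pos_part (y - c i))" for y
  define P where "P = integral {0..a} (\<lambda>y. exp (- \<psi> y))"
  define C where "C = sqrt (2 * pi * exp 1) * \<sigma>"
  define L where "L = gauss_tails \<sigma> a \<psi>"
  define r where "r y = exp (- L y) / (P + C)" for y
  define f where "f = (\<lambda>(x, y). normal_density (g x) \<sigma> y)"
  \<comment> \<open>The logarithm of the ratio of the normalisers of \<open>r\<close> and of the
    Gaussian density.\<close>
  define \<kappa> where "\<kappa> = ln (P + C) - ln (sqrt (2 * pi * \<sigma>\<^sup>2))"
  define B where "B = (\<Sum>i\<in>I. w i * a)"
  define \<tau> where "\<tau> = (\<Sum>i\<in>I. w i * \<sigma> / sqrt (2 * pi) * (1 - exp (- (a\<^sup>2 / (2 * \<sigma>\<^sup>2)))))"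
  let ?N = "density lborel (normal_density 0 \<sigma>)"
  interpret \<mu>: prob_space \<mu> by fact
  interpret N: prob_space ?N by (rule prob_space_normal_density[OF \<sigma>])
  interpret MN: pair_prob_space \<mu> ?N ..
  interpret information_space "\<mu> \<Otimes>\<^sub>M ?N" "exp 1"
    by unfold_locales simp
  interpret Q: pair_sigma_finite \<mu> lborel ..
  have [measurable]: "\<psi> \<in> borel_measurable borel"
    unfolding \<psi>_def[abs_def] by measurable
  have [measurable]: "L \<in> borel_measurable borel"
    unfolding L_def by measurable
  have [measurable]: "f \<in> borel_measurable (\<mu> \<Otimes>\<^sub>M lborel)"
    unfolding f_def normal_density_def by measurable
  have \<psi>_bound: "\<bar>\<psi> y\<bar> \<le> B" if "0 \<le> y" "y \<le> a" for y
  proof -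
    have "0 \<le> \<psi> y" using w by (simp add: \<psi>_def sum_nonneg pos_part_nonneg)
    moreover have "\<psi> y \<le> B" unfolding \<psi>_def B_def
      using that w c[THEN conjunct1] a
      by (intro sum_mono mult_left_mono) (force simp: pos_part_def)+
    ultimately show ?thesis by simp
  qed
  have C: "0 < C" using \<sigma> by (simp add: C_def)
  have \<psi>_cont: "continuous_on {0..a} \<psi>"
    unfolding \<psi>_def[abs_def] pos_part_def by (intro continuous_intros)
  have P: "0 \<le> P"
    unfolding P_def
    by (intro Henstock_Kurzweil_Integration.integral_nonneg integrable_continuous_interval
        continuous_intros \<psi>_cont) simp
  have intr: "has_bochner_integral lborel (\<lambda>y. exp (- L y)) (P + C)"
    using has_bochner_integral_exp_gauss_tails[OF \<sigma> a \<psi>_cont] by (simp add: L_def P_def C_def)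
  have rpos: "0 < r y" for y using P C by (simp add: r_def)
  have r1: "(\<integral>\<^sup>+y. r y \<partial>lborel) \<le> 1"
  proof -
    have "has_bochner_integral lborel r ((P + C) / (P + C))"
      unfolding r_def using intr P C by (intro has_bochner_integral_divide) auto
    then have "(\<integral>\<^sup>+y. r y \<partial>lborel) = ennreal ((P + C) / (P + C))"
      by (subst nn_integral_eq_integral)
        (use rpos in \<open>auto simp: has_bochner_integral_iff less_imp_le\<close>)
    then show ?thesis using P C by simp
  qed
  have F_eq: "f (x, y) * log (exp 1) (f (x, y) / r y)
    = normal_density (g x) \<sigma> y * (\<kappa> - (y - g x)\<^sup>2 / (2 * \<sigma>\<^sup>2) + L y)" for x y
  proof -
    have "ln (normal_density (g x) \<sigma> y / r y) = \<kappa> - (y - g x)\<^sup>2 / (2 * \<sigma>\<^sup>2) + L y"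
      using \<sigma> P C normal_density_pos[OF \<sigma>, of "g x" y] rpos[of y]
      by (simp add: ln_div ln_mult \<kappa>_def r_def normal_density_def)
    then show ?thesis by (simp add: f_def log_def)
  qed
  let ?F = "\<lambda>s y. normal_density s \<sigma> y * (\<kappa> - (y - s)\<^sup>2 / (2 * \<sigma>\<^sup>2) + L y)"
  have second: "has_bochner_integral lborel (\<lambda>y. normal_density s \<sigma> y * (y - s)\<^sup>2) (\<sigma>\<^sup>2)" for s
    using normal_moment_even[OF \<sigma>, of s 1] by (simp add: fact_numeral)
  have intL: "integrable lborel (\<lambda>y. normal_density s \<sigma> y * L y)" if "0 \<le> s" "s \<le> a" for s
    unfolding L_def by (rule integrable_normal_gauss_tails[OF \<sigma> that \<psi>_bound]) measurable
  have F_bochner: "has_bochner_integral lborel (?F s)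
      (\<kappa> * 1 - 1 / (2 * \<sigma>\<^sup>2) * \<sigma>\<^sup>2 + (\<integral>y. normal_density s \<sigma> y * L y \<partial>lborel))"
    if "0 \<le> s" "s \<le> a" for s
  proof -
    have "has_bochner_integral lborel (\<lambda>y. \<kappa> * normal_density s \<sigma> y
        - 1 / (2 * \<sigma>\<^sup>2) * (normal_density s \<sigma> y * (y - s)\<^sup>2) + normal_density s \<sigma> y * L y)
      (\<kappa> * 1 - 1 / (2 * \<sigma>\<^sup>2) * \<sigma>\<^sup>2 + (\<integral>y. normal_density s \<sigma> y * L y \<partial>lborel))"
      using second intL[OF that] \<sigma>
      by (intro has_bochner_integral_add has_bochner_integral_diff has_bochner_integral_mult_right)
        (auto simp: has_bochner_integral_iff)
    then show ?thesis by (simp add: algebra_simps)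
  qed
  have F_int: "integrable lborel (?F s)" if "0 \<le> s" "s \<le> a" for s
    using F_bochner[OF that] by (auto simp: has_bochner_integral_iff)
  have F_le: "(\<integral>y. ?F s y \<partial>lborel) \<le> \<kappa> - 1 / 2 + \<psi> s + \<tau>" if "0 \<le> s" "s \<le> a" for s
  proof -
    have "(\<integral>y. ?F s y \<partial>lborel) = \<kappa> - 1 / 2 + (\<integral>y. normal_density s \<sigma> y * L y \<partial>lborel)"
      using F_bochner[OF that] \<sigma> by (simp add: has_bochner_integral_iff)
    moreover have "(\<integral>y. normal_density s \<sigma> y * L y \<partial>lborel) \<le> \<psi> s + \<tau>"
      using integral_normal_gauss_tails_le[OF \<sigma> that w c] intL[OF that]
      by (simp add: L_def \<psi>_def[abs_def] \<tau>_def)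
    ultimately show ?thesis by simp
  qed
  \<comment> \<open>A bound uniform in \<open>s\<close> is what Fubini needs to make the dual
    integrand integrable on the product. The quadratic terms of the Gaussian and of \<open>L\<close>
    add up to \<open>(y - s)\<^sup>2 / \<sigma>\<^sup>2\<close>, whose mean is the final 1.\<close>
  have F_abs: "(\<integral>y. \<bar>?F s y\<bar> \<partial>lborel) \<le> \<bar>\<kappa>\<bar> + \<bar>B\<bar> + 1 / 2 + 1" if "0 \<le> s" "s \<le> a" for s
  proof -
    have "(\<integral>y. \<bar>?F s y\<bar> \<partial>lborel) \<le> (\<integral>y. (\<bar>\<kappa>\<bar> + \<bar>B\<bar> + 1 / 2) * normal_density s \<sigma> y
      + 1 / \<sigma>\<^sup>2 * (normal_density s \<sigma> y * (y - s)\<^sup>2) \<partial>lborel)"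
    proof (rule integral_mono)
      show "integrable lborel (\<lambda>y. \<bar>?F s y\<bar>)" using F_int[OF that] by (rule integrable_abs)
      show "integrable lborel (\<lambda>y. (\<bar>\<kappa>\<bar> + \<bar>B\<bar> + 1 / 2) * normal_density s \<sigma> y
        + 1 / \<sigma>\<^sup>2 * (normal_density s \<sigma> y * (y - s)\<^sup>2))"
        using second \<sigma> by (auto simp: has_bochner_integral_iff)
      fix y
      have "0 \<le> (y - s)\<^sup>2 / (2 * \<sigma>\<^sup>2)" by simp
      moreover have "(y - s)\<^sup>2 / (2 * \<sigma>\<^sup>2) + (y - s)\<^sup>2 / (2 * \<sigma>\<^sup>2) = (y - s)\<^sup>2 / \<sigma>\<^sup>2"
        using \<sigma> by (simp add: field_simps)
      moreover have "\<bar>L y\<bar> \<le> \<bar>B\<bar> + 1 / 2 + (y - s)\<^sup>2 / (2 * \<sigma>\<^sup>2)"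
        unfolding L_def by (rule abs_gauss_tails_le[OF \<sigma> that \<psi>_bound])
      ultimately have "\<bar>\<kappa> - (y - s)\<^sup>2 / (2 * \<sigma>\<^sup>2) + L y\<bar>
        \<le> \<bar>\<kappa>\<bar> + \<bar>B\<bar> + 1 / 2 + (y - s)\<^sup>2 / \<sigma>\<^sup>2"
        by linarith
      then have "\<bar>?F s y\<bar> \<le> normal_density s \<sigma> y * (\<bar>\<kappa>\<bar> + \<bar>B\<bar> + 1 / 2 + (y - s)\<^sup>2 / \<sigma>\<^sup>2)"
        by (simp add: abs_mult mult_left_mono)
      then show "\<bar>?F s y\<bar> \<le> (\<bar>\<kappa>\<bar> + \<bar>B\<bar> + 1 / 2) * normal_density s \<sigma> y
        + 1 / \<sigma>\<^sup>2 * (normal_density s \<sigma> y * (y - s)\<^sup>2)"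
        by (simp add: algebra_simps)
    qed
    also have "\<dots> = \<bar>\<kappa>\<bar> + \<bar>B\<bar> + 1 / 2 + 1"
      using second \<sigma> by (simp add: has_bochner_integral_iff)
    finally show ?thesis .
  qed
  let ?G = "\<lambda>z. f z * log (exp 1) (f z / r (snd z))"
  have [measurable]: "r \<in> borel_measurable borel" unfolding r_def by measurable
  have Gm: "?G \<in> borel_measurable (\<mu> \<Otimes>\<^sub>M lborel)" by measurable
  have G_int: "integrable (\<mu> \<Otimes>\<^sub>M lborel) ?G"
  proof (rule Q.Fubini_integrable[OF Gm])
    show "AE x in \<mu>. integrable lborel (\<lambda>y. ?G (x, y))"
      using g by eventually_elim (simp add: F_eq F_int)
    show "integrable \<mu> (\<lambda>x. \<integral>y. norm (?G (x, y)) \<partial>lborel)"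
    proof (rule \<mu>.integrable_const_bound)
      show "AE x in \<mu>. norm (\<integral>y. norm (?G (x, y)) \<partial>lborel) \<le> \<bar>\<kappa>\<bar> + \<bar>B\<bar> + 1 / 2 + 1"
        using g
      proof eventually_elim
        case (elim x)
        have "norm (\<integral>y. norm (?G (x, y)) \<partial>lborel) = (\<integral>y. \<bar>?F (g x) y\<bar> \<partial>lborel)"
          by (simp add: F_eq)
        then show ?case using F_abs[of "g x"] elim by simp
      qed
      show "(\<lambda>x. \<integral>y. norm (?G (x, y)) \<partial>lborel) \<in> borel_measurable \<mu>"
        by measurable
    qed
  qed
  have psi_int: "integrable \<mu> (\<lambda>x. pos_part (g x - c i))" if "i \<in> I" for i
  proof (rule \<mu>.integrable_const_bound)
    show "AE x in \<mu>. norm (pos_part (g x - c i)) \<le> a"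
      using g by eventually_elim (use c[OF that] in \<open>auto simp: pos_part_def\<close>)
  qed measurable
  have "prob_space.mutual_information (\<mu> \<Otimes>\<^sub>M ?N) (exp 1) \<mu> lborel fst (\<lambda>\<omega>. g (fst \<omega>) + snd \<omega>)
    \<le> integral\<^sup>L (\<mu> \<Otimes>\<^sub>M lborel) ?G"
  proof (rule mutual_information_le_dual[OF \<mu> sigma_finite_lborel])
    show "distr (\<mu> \<Otimes>\<^sub>M ?N) \<mu> fst = \<mu>"
      by (rule N.distr_pair_fst)
    have "distributed (\<mu> \<Otimes>\<^sub>M ?N) (\<mu> \<Otimes>\<^sub>M lborel) (\<lambda>\<omega>. (fst \<omega>, g (fst \<omega>) + snd \<omega>))
      (\<lambda>(x, y). ennreal (normal_density 0 \<sigma> (y - g x)))"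
      by (rule distributed_additive_noise[OF \<mu> N.prob_space_axioms]) measurable
    also have "(\<lambda>(x, y). ennreal (normal_density 0 \<sigma> (y - g x))) = (\<lambda>z. ennreal (f z))"
      by (auto simp: f_def normal_density_def)
    finally show "distributed (\<mu> \<Otimes>\<^sub>M ?N) (\<mu> \<Otimes>\<^sub>M lborel) (\<lambda>\<omega>. (fst \<omega>, g (fst \<omega>) + snd \<omega>)) f" .
    show "0 < f (x, y)" for x y using normal_density_pos[OF \<sigma>] by (simp add: f_def)
    show "integrable (\<mu> \<Otimes>\<^sub>M lborel) ?G" by (rule G_int)
  qed (use rpos r1 in auto)
  also have "\<dots> = (\<integral>x. \<integral>y. ?G (x, y) \<partial>lborel \<partial>\<mu>)"
    using Q.integral_fst'[OF G_int] by simp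
  also have "\<dots> \<le> (\<integral>x. \<kappa> - 1 / 2 + \<psi> (g x) + \<tau> \<partial>\<mu>)"
  proof (rule integral_mono_AE)
    show "integrable \<mu> (\<lambda>x. \<integral>y. ?G (x, y) \<partial>lborel)" by (rule Q.integrable_fst'[OF G_int])
    show "integrable \<mu> (\<lambda>x. \<kappa> - 1 / 2 + \<psi> (g x) + \<tau>)"
      using psi_int by (simp add: \<psi>_def)
    show "AE x in \<mu>. (\<integral>y. ?G (x, y) \<partial>lborel) \<le> \<kappa> - 1 / 2 + \<psi> (g x) + \<tau>"
      using g by eventually_elim (use F_le in \<open>simp add: F_eq\<close>)
  qed
  also have "\<dots> = \<kappa> - 1 / 2 + (\<Sum>i\<in>I. w i * (\<integral>x. pos_part (g x - c i) \<partial>\<mu>)) + \<tau>"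
    using psi_int by (simp add: \<psi>_def \<mu>.prob_space)
  \<comment> \<open>The entropy term \<open>1 / 2\<close> supplies the factor
    \<open>sqrt (exp 1)\<close> that turns the Gaussian normaliser into \<open>C\<close>.\<close>
  also have "\<kappa> - 1 / 2 = ln (1 + P / C)"
  proof -
    have "ln (1 + P / C) = ln ((P + C) / C)" using C by (simp add: field_simps)
    also have "\<dots> = ln (P + C) - ln C" using P C by (simp add: ln_div)
    also have "ln C = ln (sqrt (2 * pi * \<sigma>\<^sup>2)) + 1 / 2"
      using \<sigma> by (simp add: C_def ln_sqrt ln_mult ln_realpow add_divide_distrib)
    finally show ?thesis by (simp add: \<kappa>_def)
  qed
  finally show ?thesis by (simp add: P_def \<psi>_def C_def \<tau>_def)
qed

section \<open>From the scalar Gaussian bound to the vector input\<close>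

lemma cumsum_split:
  assumes "i \<le> n"
  shows "(\<Sum>k=1..n. f k) = cumsum f i + (\<Sum>k=i+1..n. f k)"
  unfolding cumsum_def using sum.ub_add_nat[of 1 i f "n - i"] assms by simp

lemma admissible_lawsD:
  assumes "\<mu> \<in> admissible_laws n \<alpha>"
  shows "prob_space \<mu>" "sets \<mu> = sets (input_space n)"
    and "AE x in \<mu>. \<forall>k\<in>{1..n}. 0 \<le> x k \<and> x k \<le> 1"
    and "\<And>k. k \<in> {1..n} \<Longrightarrow> (\<integral>x. x k \<partial>\<mu>) \<le> \<alpha> k"
    and "\<And>k. k \<in> {1..n} \<Longrightarrow> integrable \<mu> (\<lambda>x. x k)"
proof -
  show "prob_space \<mu>" and S [measurable_cong]: "sets \<mu> = sets (input_space n)"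
    using assms by (auto simp: admissible_laws_def)
  interpret prob_space \<mu> by fact
  show AE: "AE x in \<mu>. \<forall>k\<in>{1..n}. 0 \<le> x k \<and> x k \<le> 1"
    using assms by (intro AE_finite_allI) (auto simp: admissible_laws_def)
  show "(\<integral>x. x k \<partial>\<mu>) \<le> \<alpha> k" if "k \<in> {1..n}" for k
    using assms that by (auto simp: admissible_laws_def)
  show "integrable \<mu> (\<lambda>x. x k)" if k: "k \<in> {1..n}" for k
  proof (rule integrable_const_bound)
    show "AE x in \<mu>. norm (x k) \<le> 1" using AE by eventually_elim (use k in auto)
    show "(\<lambda>x. x k) \<in> borel_measurable \<mu>" using k by measurable
  qed
qed

text \<open>Mutual information depends on the two target spaces only through their sigma-algebras.
  The input space may therefore be replaced by \<open>\<mu>\<close> and \<open>borel\<close> by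
  \<open>lborel\<close>, the reference measures of the dual bound.\<close>

lemma channel_information_eq:
  assumes \<mu>: "prob_space \<mu>" and S: "sets \<mu> = sets (input_space n)" and \<sigma>: "0 < \<sigma>"
  shows "channel_information n h \<sigma> \<mu> =
    prob_space.mutual_information (\<mu> \<Otimes>\<^sub>M density lborel (normal_density 0 \<sigma>)) (exp 1)
      \<mu> lborel fst (\<lambda>\<omega>. (\<Sum>k=1..n. h k * fst \<omega> k) + snd \<omega>)"
proof -
  interpret \<mu>: prob_space \<mu> by fact
  interpret N: prob_space "density lborel (normal_density 0 \<sigma>)"
    by (rule prob_space_normal_density[OF \<sigma>])
  interpret MN: pair_prob_space \<mu> "density lborel (normal_density 0 \<sigma>)" ..
  have out: "channel_output n h = (\<lambda>\<omega>. (\<Sum>k=1..n. h k * fst \<omega> k) + snd \<omega>)"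
    by (auto simp: channel_output_def)
  have S2: "sets (input_space n \<Otimes>\<^sub>M (borel :: real measure)) = sets (\<mu> \<Otimes>\<^sub>M lborel)"
    using S by (intro sets_pair_measure_cong) auto
  show ?thesis
    unfolding channel_information_def channel_space_def out MN.mutual_information_def
    by (intro arg_cong2[where f = "KL_divergence (exp 1)"]
        arg_cong2[where f = "(\<Otimes>\<^sub>M)"] distr_cong refl) (auto simp: S S2)
qed

text \<open>Since each coordinate is at most 1, the first \<open>i\<close> terms of the weighted sum
  are at most \<open>cumsum h i\<close>. The excess over this threshold is thus bounded by the
  remaining terms, which are nonnegative and so bound the positive part too.\<close>

lemma integral_pos_part_input_le:
  assumes \<mu>: "\<mu> \<in> admissible_laws n \<alpha>" and h: "\<And>k. k \<in> {1..n} \<Longrightarrow> 0 < h k"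
    and h1: "(\<Sum>k=1..n. h k) = 1" and i: "i < n"
  shows "(\<integral>x. pos_part ((\<Sum>k=1..n. h k * x k) - cumsum h i) \<partial>\<mu>)
    \<le> (1 - cumsum h i) * tail_mean n h \<alpha> i"
proof -
  note A = admissible_lawsD[OF \<mu>]
  interpret prob_space \<mu> by (rule A)
  have [measurable_cong]: "sets \<mu> = sets (input_space n)" by (rule A)
  have "(\<integral>x. pos_part ((\<Sum>k=1..n. h k * x k) - cumsum h i) \<partial>\<mu>)
    \<le> (\<integral>x. (\<Sum>k=i+1..n. h k * x k) \<partial>\<mu>)"
  proof (rule integral_mono_AE')
    show "integrable \<mu> (\<lambda>x. \<Sum>k=i+1..n. h k * x k)"
      by (intro Bochner_Integration.integrable_sum integrable_mult_right A(5)) auto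
    show "AE x in \<mu>. pos_part ((\<Sum>k=1..n. h k * x k) - cumsum h i) \<le> (\<Sum>k=i+1..n. h k * x k)"
      using A(3)
    proof eventually_elim
      case (elim x)
      have "cumsum (\<lambda>k. h k * x k) i \<le> cumsum h i"
        unfolding cumsum_def using elim h i
        by (intro sum_mono) (simp add: mult_left_le less_imp_le)
      moreover have "0 \<le> (\<Sum>k=i+1..n. h k * x k)"
        using elim h by (intro sum_nonneg) (simp add: less_imp_le)
      ultimately show ?case
        using cumsum_split[of i n "\<lambda>k. h k * x k"] i by (simp add: pos_part_def)
    qed
    show "AE x in \<mu>. 0 \<le> (\<Sum>k=i+1..n. h k * x k)"
      using A(3) by eventually_elim (use h in \<open>auto intro!: sum_nonneg simp: less_imp_le\<close>)
  qed
  also have "\<dots> = (\<Sum>k=i+1..n. h k * (\<integral>x. x k \<partial>\<mu>))"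
    by (subst Bochner_Integration.integral_sum) (use A(5) in auto)
  also have "\<dots> \<le> (\<Sum>k=i+1..n. h k * \<alpha> k)"
    using A(4) h by (intro sum_mono mult_left_mono) (auto simp: less_imp_le)
  also have "\<dots> = (1 - cumsum h i) * tail_mean n h \<alpha> i"
  proof -
    \<comment> \<open>With \<open>i < n\<close> some weight remains beyond \<open>i\<close>, so the
      denominator in \<open>tail_mean\<close> is nonzero and cancels.\<close>
    have "0 < (\<Sum>k=i+1..n. h k)" using h i by (intro sum_pos) auto
    then have "1 - cumsum h i \<noteq> 0" using cumsum_split[of i n h] h1 i by simp
    then show ?thesis by (simp add: tail_mean_def)
  qed
  finally show ?thesis .
qed

section \<open>Supremum over all admissible input laws\<close>

theorem theorem8:
  fixes n :: nat and h \<alpha> lam :: "nat \<Rightarrow> real" and \<sigma> \<delta> :: real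
  assumes "2 \<le> n"
    and "\<And>k. k \<in> {1..n} \<Longrightarrow> 0 < h k"
    and "(\<Sum>k=1..n. h k) = 1"
    and "\<alpha> 1 \<le> 1"
    and "\<And>j k. 1 \<le> j \<Longrightarrow> j < k \<Longrightarrow> k \<le> n \<Longrightarrow> \<alpha> k < \<alpha> j"
    and "0 < \<alpha> n"
    and "\<alpha> n \<le> 1 / 2"
    and "0 < \<sigma>"
    and "0 < \<delta>"
    and "\<And>i. i \<in> {0..n-1} \<Longrightarrow> 0 \<le> lam i"
  shows "capacity_BC n h \<alpha> \<sigma> \<le> ereal
      (ln (1 + P_int n h lam \<delta> / (sqrt (2 * pi * exp 1) * \<sigma>))
       + (\<Sum>i=0..n-1. lam i * (1 - cumsum h i) * tail_mean n h \<alpha> i)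
       + (\<Sum>i=0..n-1. lam i * \<sigma> / sqrt (2 * pi) * (1 - exp (- ((1 + \<delta>)^2 / (2 * \<sigma>^2))))))"
  unfolding capacity_BC_def
proof (rule SUP_least, subst ereal_less_eq)
  note n = assms(1) and h = assms(2) and h1 = assms(3) and \<sigma> = assms(8) and \<delta> = assms(9)
    and lam = assms(10)
  fix \<mu> assume \<mu>: "\<mu> \<in> admissible_laws n \<alpha>"
  note A = admissible_lawsD[OF \<mu>]
  have [measurable_cong]: "sets \<mu> = sets (input_space n)" by (rule A)
  have c: "0 \<le> cumsum h i \<and> cumsum h i \<le> 1 + \<delta>" if "i \<in> {0..n-1}" for i
  proof -
    have "0 \<le> cumsum h i"
      unfolding cumsum_def by (intro sum_nonneg less_imp_le h) (use that in auto)
    moreover have "0 \<le> (\<Sum>k=i+1..n. h k)"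
      using h by (intro sum_nonneg) (simp add: less_imp_le)
    moreover have "i \<le> n" using that by simp
    ultimately show ?thesis using cumsum_split[of i n h] h1 \<delta> by simp
  qed
  have g: "AE x in \<mu>. 0 \<le> (\<Sum>k=1..n. h k * x k) \<and> (\<Sum>k=1..n. h k * x k) \<le> 1 + \<delta>"
    using A(3)
  proof eventually_elim
    case (elim x)
    have "(\<Sum>k=1..n. h k * x k) \<le> (\<Sum>k=1..n. h k)"
      using elim h by (intro sum_mono) (simp add: mult_left_le less_imp_le)
    moreover have "0 \<le> (\<Sum>k=1..n. h k * x k)"
      using elim h by (intro sum_nonneg) (simp add: less_imp_le)
    ultimately show ?case using h1 \<delta> by simp
  qed
  \<comment> \<open>The threshold of index 0 is 0, and on \<open>[0, 1 + \<delta>]\<close> the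
    positive part of \<open>y\<close> is \<open>y\<close>; the separate linear term is thus the
    summand \<open>i = 0\<close>.\<close>
  have P: "P_int n h lam \<delta>
    = integral {0..1+\<delta>} (\<lambda>y. exp (- (\<Sum>i\<in>{0..n-1}. lam i * pos_part (y - cumsum h i))))"
    unfolding P_int_def
  proof (rule Henstock_Kurzweil_Integration.integral_cong)
    fix y assume "y \<in> {0..1+\<delta>}"
    then show "exp (- lam 0 * y - (\<Sum>i=1..n-1. lam i * pos_part (y - cumsum h i)))
      = exp (- (\<Sum>i\<in>{0..n-1}. lam i * pos_part (y - cumsum h i)))"
      by (subst (2) sum.atLeast_Suc_atMost) (auto simp: cumsum_def pos_part_def)
  qed
  have "channel_information n h \<sigma> \<mu>
    \<le> ln (1 + P_int n h lam \<delta> / (sqrt (2 * pi * exp 1) * \<sigma>))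
      + (\<Sum>i\<in>{0..n-1}. lam i * (\<integral>x. pos_part ((\<Sum>k=1..n. h k * x k) - cumsum h i) \<partial>\<mu>))
      + (\<Sum>i\<in>{0..n-1}. lam i * \<sigma> / sqrt (2 * pi) * (1 - exp (- ((1 + \<delta>)^2 / (2 * \<sigma>^2)))))"
    unfolding channel_information_eq[OF A(1,2) \<sigma>] P
    by (rule gaussian_channel_information_le[OF A(1) \<sigma> _ _ g lam c]) (use \<delta> in auto)
  also have "\<dots> \<le> ln (1 + P_int n h lam \<delta> / (sqrt (2 * pi * exp 1) * \<sigma>))
       + (\<Sum>i=0..n-1. lam i * ((1 - cumsum h i) * tail_mean n h \<alpha> i))
       + (\<Sum>i=0..n-1. lam i * \<sigma> / sqrt (2 * pi) * (1 - exp (- ((1 + \<delta>)^2 / (2 * \<sigma>^2)))))"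
    using integral_pos_part_input_le[OF \<mu> h h1] lam n
    by (intro add_mono sum_mono mult_left_mono order_refl) auto
  finally show "channel_information n h \<sigma> \<mu>
    \<le> ln (1 + P_int n h lam \<delta> / (sqrt (2 * pi * exp 1) * \<sigma>))
       + (\<Sum>i=0..n-1. lam i * (1 - cumsum h i) * tail_mean n h \<alpha> i)
       + (\<Sum>i=0..n-1. lam i * \<sigma> / sqrt (2 * pi) * (1 - exp (- ((1 + \<delta>)^2 / (2 * \<sigma>^2)))))"
    by (simp only: mult.assoc)
qed

end
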